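(* For any $t,p\in\mathbb{N}$, $$\Delta(\mathcal{P}^{(p)},\mathcal{P}^{(p,t)})\le 2p^2\,2^{-2t/3}.$$ Consequently, if $t=t(p)\ge(3+\varepsilon)\log_2 p$ for any $\varepsilon>0$, then $\{\mathcal{P}^{(p)}\}_{p\in\mathbb{N}}$ and $\{\mathcal{P}^{(p,t(p))}\}_{p\in\mathbb{N}}$ are asymptotically equivalent as $p\to\infty$, that is, $\Delta(\mathcal{P}^{(p)},\mathcal{P}^{(p,t(p))})\to0$.
   Context: For $\theta\in\mathbb{R}^{p\times p}$, $\mathbb{P}_\theta$ is the law of a $p\times p$ random matrix $X$ with independent entries $X_{ij}\sim N(\theta_{ij},1)$. For $t\in\mathbb{N}$ and $x\in\mathbb{R}$, $[x]_t=2^{-t}\lfloor2^tx\rfloor$, applied entrywise to matrices, and $\mathbb{P}^t_\theta$ is the law of $[X]_t$ when $X\sim\mathbb{P}_\theta$. Define the experiments $\mathcal{P}^{(p)}=\{\mathbb{P}_\theta:\theta\in\mathbb{R}^{p\times p}\}$ and $\mathcal{P}^{(p,t)}=\{\mathbb{P}_\theta^t:\theta\in\mathbb{R}^{p\times p}\}$. Total variation: $\mathsf{TV}(P,Q)=1-\int(\mathrm{d}P\wedge\mathrm{d}Q)$. For experiments $\mathcal{P}=\{P_\theta:\theta\in\Theta\}$ on a standard Borel space $(\mathsf{X},\mathcal{F})$ and $\mathcal{Q}=\{Q_\theta:\theta\in\Theta\}$ on a standard Borel space $(\mathsf{Y},\mathcal{G})$ with common parameter space $\Theta$, the Le Cam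 deficiency is $$\delta(\mathcal{P},\mathcal{Q})=\inf_T\sup_{\theta\in\Theta}\mathsf{TV}(TP_\theta,Q_\theta),$$ the infimum being over all probability transition (Markov) kernels $T$ from $(\mathsf{X},\mathcal{F})$ to $(\mathsf{Y},\mathcal{G})$, with $TP(\mathrm{d}y)=\int_{\mathsf{X}}T(\mathrm{d}y\mid x)P(\mathrm{d}x)$. The Le Cam distance is $\Delta(\mathcal{P},\mathcal{Q})=\max\{\delta(\mathcal{P},\mathcal{Q}),\delta(\mathcal{Q},\mathcal{P})\}$. Two sequences of experiments are asymptotically equivalent if their Le Cam distance tends to $0$ as $p\to\infty$. *)

theory Defs
  imports "HOL-Probability.Probability"
begin

text \<open>The measure \<open>P \<and> Q\<close> is the lattice infimum \<open>inf P Q\<close> in the library order on measures,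
  i.e. for measures on a common \<open>\<sigma>\<close>-algebra the largest measure dominated by both.
  The lemma \<open>total_variation_density\<close> below confirms that its density is the pointwise minimum.\<close>

definition total_variation :: "'a measure \<Rightarrow> 'a measure \<Rightarrow> real" where
  "total_variation P Q = 1 - measure (inf P Q) (space P)"

lemma inf_density:
  assumes [measurable]: "f \<in> borel_measurable M" "g \<in> borel_measurable M"
  shows "inf (density M f) (density M g) = density M (\<lambda>x. min (f x) (g x))"
proof (rule antisym)
  let ?R = "inf (density M f) (density M g)" and ?D = "density M (\<lambda>x. min (f x) (g x))"
  have D: "?D \<le> density M f" "?D \<le> density M g"
    by (auto simp: le_measure emeasure_density intro!: nn_integral_mono mult_right_mono)
  then show DR: "?D \<le> ?R"
    by (rule inf_greatest)
  have "?R \<le> density M f" "?R \<le> density M g"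
    by simp_all
  with DR have sp: "space ?R = space M" and se: "sets ?R = sets M"
    by (auto simp: le_measure_iff split: if_splits)
  have "emeasure ?R A \<le> emeasure ?D A" if A[measurable]: "A \<in> sets M" for A
  proof -
    let ?B = "{x \<in> space M. f x \<le> g x}"
    have AB: "A \<inter> ?B \<in> sets M" "A - ?B \<in> sets M"
      by measurable
    have "emeasure ?R A = emeasure ?R (A \<inter> ?B) + emeasure ?R (A - ?B)"
      using AB by (subst plus_emeasure) (auto simp: se intro!: arg_cong2[where f=emeasure])
    also have "\<dots> \<le> emeasure (density M f) (A \<inter> ?B) + emeasure (density M g) (A - ?B)"
      using AB se le_measure[of ?R "density M f"] le_measure[of ?R "density M g"]
        \<open>?R \<le> density M f\<close> \<open>?R \<le> density M g\<close>
      by (intro add_mono) (simp_all del: le_inf_iff inf.cobounded1 inf.cobounded2 inf_le1 inf_le2)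
    also have "\<dots> = emeasure ?D (A \<inter> ?B) + emeasure ?D (A - ?B)"
      using AB by (intro arg_cong2[where f="(+)"])
        (auto simp: emeasure_density min_def indicator_def intro!: nn_integral_cong)
    also have "\<dots> = emeasure ?D A"
      using AB by (subst plus_emeasure) (auto intro!: arg_cong2[where f=emeasure])
    finally show ?thesis .
  qed
  then show "?R \<le> ?D"
    by (subst le_measure) (auto simp: se)
qed

lemma total_variation_density:
  assumes "f \<in> borel_measurable M" "g \<in> borel_measurable M"
  shows "total_variation (density M f) (density M g) = 1 - enn2real (\<integral>\<^sup>+x. min (f x) (g x) \<partial>M)"
proof -
  have "emeasure (density M (\<lambda>x. min (f x) (g x))) (space M) = (\<integral>\<^sup>+x. min (f x) (g x) \<partial>M)"
    using assms by (subst emeasure_density) (auto intro!: nn_integral_cong)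
  then show ?thesis
    using assms by (simp add: total_variation_def inf_density measure_def)
qed

record ('p, 'a) stat_experiment =
  params :: "'p set"
  sample :: "'a measure"
  law :: "'p \<Rightarrow> 'a measure"

text \<open>The field \<open>sample\<close> only provides the measurable space on which all the laws live. Markov
  kernels are measurable maps into \<open>prob_algebra\<close>, and \<open>bind\<close> applies a kernel to a law. The two
  experiments are meant to have the same parameter space, and their laws to be probability
  measures; for a nonempty parameter space the infimum and suprema below are then over nonempty
  sets of reals in \<open>[0, 1]\<close>.\<close>

definition deficiency :: "('p, 'a) stat_experiment \<Rightarrow> ('p, 'b) stat_experiment \<Rightarrow> real" where
  "deficiency P Q =
     (INF T \<in> sample P \<rightarrow>\<^sub>M prob_algebra (sample Q).
        SUP \<theta> \<in> params P. total_variation (law P \<theta> \<bind> T) (law Q \<theta>))"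

definition le_cam_dist :: "('p, 'a) stat_experiment \<Rightarrow> ('p, 'b) stat_experiment \<Rightarrow> real" where
  "le_cam_dist P Q = max (deficiency P Q) (deficiency Q P)"

definition asymptotically_equivalent ::
    "(nat \<Rightarrow> ('p, 'a) stat_experiment) \<Rightarrow> (nat \<Rightarrow> ('p, 'b) stat_experiment) \<Rightarrow> bool" where
  "asymptotically_equivalent P Q \<longleftrightarrow> (\<lambda>p. le_cam_dist (P p) (Q p)) \<longlonglongrightarrow> 0"

text \<open>The size \<open>p\<close> varies in the statement, so a \<open>p \<times> p\<close> matrix is an extensional function on the
  index set \<open>{..<p} \<times> {..<p}\<close>.\<close>

abbreviation entries :: "nat \<Rightarrow> (nat \<times> nat) set" where
  "entries p \<equiv> {..<p} \<times> {..<p}"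

definition matrices :: "nat \<Rightarrow> (nat \<times> nat \<Rightarrow> real) set" where
  "matrices p = (entries p \<rightarrow>\<^sub>E UNIV)"

definition matrix_borel :: "nat \<Rightarrow> (nat \<times> nat \<Rightarrow> real) measure" where
  "matrix_borel p = PiM (entries p) (\<lambda>_. borel)"

definition gaussian_law :: "nat \<Rightarrow> (nat \<times> nat \<Rightarrow> real) \<Rightarrow> (nat \<times> nat \<Rightarrow> real) measure" where
  "gaussian_law p \<theta> = PiM (entries p) (\<lambda>ij. density lborel (normal_density (\<theta> ij) 1))"

definition discretize :: "nat \<Rightarrow> real \<Rightarrow> real" where
  "discretize t x = of_int \<lfloor>2 ^ t * x\<rfloor> / 2 ^ t"

definition discretize_matrix :: "nat \<Rightarrow> nat \<Rightarrow> (nat \<times> nat \<Rightarrow> real) \<Rightarrow> (nat \<times> nat \<Rightarrow> real)" where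
  "discretize_matrix p t X = (\<lambda>ij \<in> entries p. discretize t (X ij))"

definition discretized_gaussian_law ::
    "nat \<Rightarrow> nat \<Rightarrow> (nat \<times> nat \<Rightarrow> real) \<Rightarrow> (nat \<times> nat \<Rightarrow> real) measure" where
  "discretized_gaussian_law p t \<theta> = distr (gaussian_law p \<theta>) (matrix_borel p) (discretize_matrix p t)"

definition gaussian_experiment :: "nat \<Rightarrow> (nat \<times> nat \<Rightarrow> real, nat \<times> nat \<Rightarrow> real) stat_experiment" where
  "gaussian_experiment p =
     \<lparr>params = matrices p, sample = matrix_borel p, law = gaussian_law p\<rparr>"

definition discretized_gaussian_experiment ::
    "nat \<Rightarrow> nat \<Rightarrow> (nat \<times> nat \<Rightarrow> real, nat \<times> nat \<Rightarrow> real) stat_experiment" where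
  "discretized_gaussian_experiment p t =
     \<lparr>params = matrices p, sample = matrix_borel p, law = discretized_gaussian_law p t\<rparr>"

lemma gaussian_law_in_prob_algebra: "gaussian_law p \<theta> \<in> space (prob_algebra (matrix_borel p))"
  unfolding space_prob_algebra gaussian_law_def matrix_borel_def
  by (auto intro!: sets_PiM_cong prob_space_PiM prob_space_normal_density)

lemma measurable_discretize_matrix:
  "discretize_matrix p t \<in> matrix_borel p \<rightarrow>\<^sub>M matrix_borel p"
  unfolding discretize_matrix_def matrix_borel_def discretize_def by measurable

lemma discretized_gaussian_law_in_prob_algebra:
  "discretized_gaussian_law p t \<theta> \<in> space (prob_algebra (matrix_borel p))"
proof -
  have "sets (gaussian_law p \<theta>) = sets (matrix_borel p)" "prob_space (gaussian_law p \<theta>)"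
    using gaussian_law_in_prob_algebra by (auto simp: space_prob_algebra)
  then show ?thesis
    using measurable_discretize_matrix[of p t]
    by (auto simp: space_prob_algebra discretized_gaussian_law_def cong: measurable_cong_sets
        intro!: prob_space.prob_space_distr)
qed

end

theory Submission imports Defs begin

text \<open>
  Discretizing is itself a (deterministic) kernel, so passing from the Gaussian matrix to its
  discretization costs nothing. In the other direction, randomize: replace every entry by a uniform
  point of the dyadic cell it names. This sends the discretized law back to a law with a density,
  which is again a product over the entries; its one-dimensional factor at \<open>y\<close> is the average of
  the Gaussian density over the cell of \<open>y\<close> (\<open>smoothed_density\<close>).

  It remains to compare a Gaussian density \<open>\<phi>\<close> with mean \<open>\<mu>\<close> to its cell averages. Cells have length
  \<open>h = 1 / 2 ^ t\<close>, and \<open>\<phi>\<close> is symmetric and unimodal, so both \<open>\<phi> y\<close> and the average over the cell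
  of \<open>y\<close> are at least \<open>\<phi> (\<mu> + (\<bar>y - \<mu>\<bar> + h))\<close>. That function is \<open>\<phi>\<close> with a window of
  length \<open>2 * h\<close> around \<open>\<mu>\<close> cut out and the two tails pushed together. Since \<open>\<phi> \<le> 1 / 2\<close>, it
  still has mass at least \<open>1 - h\<close> (\<open>normal_smoothed_overlap\<close>).

  For product densities the minimum of the products dominates the product of the minima. The
  overlap of the two matrix laws is therefore at least \<open>(1 - h) ^ (p\<^sup>2)\<close>, and Bernoulli's inequality
  bounds the total variation by \<open>p\<^sup>2 * h\<close>, uniformly in the mean matrix
  (\<open>total_variation_product_le\<close>). This bound \<open>p\<^sup>2 / 2 ^ t\<close> on the Le Cam distance is at most
  \<open>2 * p\<^sup>2 * 2 powr (- 2 * t / 3)\<close>, and it is at most \<open>1 / p\<close> as soon as \<open>p ^ 3 \<le> 2 ^ t\<close>.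
\<close>

section \<open>Total variation and deficiency\<close>

lemma total_variation_le_1: "total_variation P Q \<le> 1"
  by (simp add: total_variation_def)

lemma total_variation_nonneg:
  assumes "prob_space P" "sets Q = sets P"
  shows "0 \<le> total_variation P Q"
proof -
  interpret P: prob_space P by fact
  have le: "inf P Q \<le> P" by simp
  \<comment> \<open>The order on measures compares spaces and \<open>\<sigma>\<close>-algebras before values, so \<open>inf P Q\<close> could a
    priori live on a smaller \<open>\<sigma>\<close>-algebra; squeezing it between two measures on \<open>sets P\<close> excludes this.\<close>
  have ge: "null_measure P \<le> inf P Q"
    using assms(2) sets_eq_imp_space_eq[OF assms(2)]
    by (intro inf_greatest) (auto simp: le_measure le_fun_def)
  have s: "sets (inf P Q) = sets P"
    using le ge by (auto simp: le_measure_iff split: if_splits)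
  have "emeasure (inf P Q) (space P) \<le> emeasure P (space P)"
    using le s le_measure[OF s] by blast
  then have "measure (inf P Q) (space P) \<le> 1"
    using P.emeasure_space_1 by (simp add: measure_def enn2real_leI)
  then show ?thesis
    by (simp add: total_variation_def)
qed

lemma total_variation_self: "prob_space P \<Longrightarrow> total_variation P P = 0"
  by (simp add: total_variation_def prob_space.prob_space)

lemma total_variation_commute: "sets P = sets Q \<Longrightarrow> total_variation P Q = total_variation Q P"
  using sets_eq_imp_space_eq[of P Q] by (simp add: total_variation_def inf.commute)

text \<open>Infima and suprema of sets of reals obey their usual laws only for nonempty bounded sets. These
  assumptions place all total variations in the definition of the deficiency in \<open>[0, 1]\<close>.\<close>

locale experiment_pair =
  fixes P :: "('p, 'a) stat_experiment" and Q :: "('p, 'b) stat_experiment"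
  assumes params_nonempty: "params P \<noteq> {}"
    and laws: "\<And>\<theta>. \<theta> \<in> params P \<Longrightarrow> law P \<theta> \<in> space (prob_algebra (sample P))"
      "\<And>\<theta>. \<theta> \<in> params P \<Longrightarrow> law Q \<theta> \<in> space (prob_algebra (sample Q))"
begin

lemma total_variation_kernel_nonneg:
  assumes "T \<in> sample P \<rightarrow>\<^sub>M prob_algebra (sample Q)" "\<theta> \<in> params P"
  shows "0 \<le> total_variation (law P \<theta> \<bind> T) (law Q \<theta>)"
  using prob_space_bind'[OF laws(1)[OF assms(2)] assms(1)]
    sets_bind'[OF laws(1)[OF assms(2)] assms(1)] laws(2)[OF assms(2)]
  by (intro total_variation_nonneg) (auto simp: space_prob_algebra)

lemma worst_case_nonneg:
  assumes "T \<in> sample P \<rightarrow>\<^sub>M prob_algebra (sample Q)"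
  shows "0 \<le> (SUP \<theta> \<in> params P. total_variation (law P \<theta> \<bind> T) (law Q \<theta>))"
proof -
  obtain \<theta> where \<theta>: "\<theta> \<in> params P"
    using params_nonempty by auto
  show ?thesis
    using total_variation_kernel_nonneg[OF assms \<theta>] \<theta>
    by (intro cSUP_upper2[where x = \<theta>]) (auto intro!: bdd_aboveI2 total_variation_le_1)
qed

lemma deficiency_le:
  assumes "T \<in> sample P \<rightarrow>\<^sub>M prob_algebra (sample Q)"
    and "\<And>\<theta>. \<theta> \<in> params P \<Longrightarrow> total_variation (law P \<theta> \<bind> T) (law Q \<theta>) \<le> c"
  shows "deficiency P Q \<le> c"
  unfolding deficiency_def
  by (intro cINF_lower2[where x = T] assms(1))
    (use worst_case_nonneg params_nonempty assms(2) in \<open>auto intro!: bdd_belowI2 cSUP_least\<close>)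

lemma deficiency_nonneg:
  assumes "T \<in> sample P \<rightarrow>\<^sub>M prob_algebra (sample Q)"
  shows "0 \<le> deficiency P Q"
  unfolding deficiency_def using assms worst_case_nonneg by (intro cINF_greatest) auto

end

section \<open>Densities of products and of mixtures\<close>

text \<open>A product measure is determined by its values on finite boxes, and there the integral of a product
  of functions of single coordinates factorizes.\<close>

lemma density_PiM:
  assumes "finite I" "product_sigma_finite M"
    and [measurable]: "\<And>i. f i \<in> borel_measurable (M i)"
    and sf: "\<And>i. sigma_finite_measure (density (M i) (f i))"
  shows "PiM I (\<lambda>i. density (M i) (f i)) = density (PiM I M) (\<lambda>x. \<Prod>i\<in>I. f i (x i))"
proof -
  interpret M: product_sigma_finite M by fact
  interpret D: product_sigma_finite "\<lambda>i. density (M i) (f i)"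
    by (rule product_sigma_finite.intro) (rule sf)
  have "density (PiM I M) (\<lambda>x. \<Prod>i\<in>I. f i (x i)) = PiM I (\<lambda>i. density (M i) (f i))"
  proof (rule D.PiM_eqI[OF \<open>finite I\<close>])
    show "sets (density (PiM I M) (\<lambda>x. \<Prod>i\<in>I. f i (x i))) = sets (PiM I (\<lambda>i. density (M i) (f i)))"
      by (auto intro!: sets_PiM_cong)
  next
    fix A assume A: "\<And>i. i \<in> I \<Longrightarrow> A i \<in> sets (density (M i) (f i))"
    have "emeasure (density (PiM I M) (\<lambda>x. \<Prod>i\<in>I. f i (x i))) (Pi\<^sub>E I A)
        = (\<integral>\<^sup>+x. (\<Prod>i\<in>I. f i (x i)) * indicator (Pi\<^sub>E I A) x \<partial>PiM I M)"
      using A \<open>finite I\<close> by (intro emeasure_density) (auto intro!: sets_PiM_I_finite)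
    also have "\<dots> = (\<integral>\<^sup>+x. (\<Prod>i\<in>I. f i (x i) * indicator (A i) (x i)) \<partial>PiM I M)"
    proof (rule nn_integral_cong)
      fix x assume "x \<in> space (PiM I M)"
      then have "indicator (Pi\<^sub>E I A) x = (\<Prod>i\<in>I. indicator (A i) (x i) :: ennreal)"
        using \<open>finite I\<close>
        by (auto simp: indicator_def space_PiM PiE_def Pi_def intro!: prod_zero)
      then show "(\<Prod>i\<in>I. f i (x i)) * indicator (Pi\<^sub>E I A) x
          = (\<Prod>i\<in>I. f i (x i) * indicator (A i) (x i))"
        by (simp add: prod.distrib)
    qed
    also have "\<dots> = (\<Prod>i\<in>I. \<integral>\<^sup>+x. f i x * indicator (A i) x \<partial>M i)"
      using A \<open>finite I\<close> by (intro M.product_nn_integral_prod) auto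
    also have "\<dots> = (\<Prod>i\<in>I. emeasure (density (M i) (f i)) (A i))"
      using A by (intro prod.cong refl) (auto simp: emeasure_density)
    finally show "emeasure (density (PiM I M) (\<lambda>x. \<Prod>i\<in>I. f i (x i))) (Pi\<^sub>E I A)
        = (\<Prod>i\<in>I. emeasure (density (M i) (f i)) (A i))" .
  qed
  then show ?thesis by simp
qed

lemma measurable_density_kernel:
  assumes "sigma_finite_measure N"
    and k[measurable]: "case_prod k \<in> borel_measurable (M \<Otimes>\<^sub>M N)"
    and prob: "\<And>x. x \<in> space M \<Longrightarrow> prob_space (density N (k x))"
  shows "(\<lambda>x. density N (k x)) \<in> M \<rightarrow>\<^sub>M prob_algebra N"
proof -
  interpret N: sigma_finite_measure N by fact
  have "(\<lambda>x. emeasure (density N (k x)) A) \<in> borel_measurable M" if A[measurable]: "A \<in> sets N" for A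
  proof -
    have "(\<lambda>x. \<integral>\<^sup>+y. k x y * indicator A y \<partial>N) \<in> borel_measurable M"
      by measurable
    then show ?thesis
      by (rule measurable_cong[THEN iffD1, rotated]) (subst emeasure_density, auto)
  qed
  then show ?thesis
    by (intro measurable_prob_algebraI prob measurable_subprob_algebra)
      (auto intro: prob_space_imp_subprob_space prob)
qed

text \<open>Tonelli's theorem: integrating the kernel densities against \<open>f\<close> commutes with integrating over the
  event.\<close>

lemma bind_density_kernel:
  assumes M: "sigma_finite_measure M" and N: "sigma_finite_measure N"
    and f[measurable]: "f \<in> borel_measurable M"
    and k[measurable]: "case_prod k \<in> borel_measurable (M \<Otimes>\<^sub>M N)"
    and prob: "prob_space (density M f)" "\<And>x. x \<in> space M \<Longrightarrow> prob_space (density N (k x))"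
  shows "density M f \<bind> (\<lambda>x. density N (k x)) = density N (\<lambda>y. \<integral>\<^sup>+x. f x * k x y \<partial>M)"
proof -
  interpret M: sigma_finite_measure M by fact
  interpret N: sigma_finite_measure N by fact
  interpret MN: pair_sigma_finite M N ..
  have f_law: "density M f \<in> space (prob_algebra M)"
    using prob(1) by (simp add: space_prob_algebra)
  have kernel: "(\<lambda>x. density N (k x)) \<in> M \<rightarrow>\<^sub>M prob_algebra N"
    by (rule measurable_density_kernel[OF N k prob(2)])
  show ?thesis
  proof (rule measure_eqI)
    show "sets (density M f \<bind> (\<lambda>x. density N (k x))) = sets (density N (\<lambda>y. \<integral>\<^sup>+x. f x * k x y \<partial>M))"
      using sets_bind'[OF f_law kernel] by simp
    fix A assume "A \<in> sets (density M f \<bind> (\<lambda>x. density N (k x)))"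
    then have A[measurable]: "A \<in> sets N"
      using sets_bind'[OF f_law kernel] by simp
    have "emeasure (density M f \<bind> (\<lambda>x. density N (k x))) A
        = (\<integral>\<^sup>+x. emeasure (density N (k x)) A \<partial>density M f)"
      by (rule emeasure_bind_prob_algebra[OF f_law kernel A])
    also have "\<dots> = (\<integral>\<^sup>+x. f x * emeasure (density N (k x)) A \<partial>M)"
      using measurable_emeasure_kernel[OF measurable_prob_algebraD[OF kernel] A]
      by (intro nn_integral_density) auto
    also have "\<dots> = (\<integral>\<^sup>+x. \<integral>\<^sup>+y. f x * k x y * indicator A y \<partial>N \<partial>M)"
    proof (rule nn_integral_cong)
      fix x assume [measurable]: "x \<in> space M"
      have "emeasure (density N (k x)) A = (\<integral>\<^sup>+y. k x y * indicator A y \<partial>N)"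
        by (rule emeasure_density) measurable
      then show "f x * emeasure (density N (k x)) A = (\<integral>\<^sup>+y. f x * k x y * indicator A y \<partial>N)"
        by (simp add: nn_integral_cmult mult.assoc)
    qed
    also have "\<dots> = (\<integral>\<^sup>+y. \<integral>\<^sup>+x. f x * k x y * indicator A y \<partial>M \<partial>N)"
      by (rule MN.Fubini'[symmetric]) measurable
    also have "\<dots> = (\<integral>\<^sup>+y. (\<integral>\<^sup>+x. f x * k x y \<partial>M) * indicator A y \<partial>N)"
      by (intro nn_integral_cong nn_integral_multc) measurable
    also have "\<dots> = emeasure (density N (\<lambda>y. \<integral>\<^sup>+x. f x * k x y \<partial>M)) A"
      by (rule emeasure_density[symmetric]) measurable
    finally show "emeasure (density M f \<bind> (\<lambda>x. density N (k x))) A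
        = emeasure (density N (\<lambda>y. \<integral>\<^sup>+x. f x * k x y \<partial>M)) A" .
  qed
qed

text \<open>Taking the minimum coordinatewise can only lose mass, and the coordinatewise overlap is
  multiplicative. So the overlap of the products is at least \<open>(1 - e) ^ card I\<close>, which Bernoulli's
  inequality bounds below by \<open>1 - card I * e\<close>.\<close>

lemma total_variation_product_le:
  fixes e :: real
  assumes "finite I" "product_sigma_finite M"
    and f[measurable]: "\<And>i. f i \<in> borel_measurable (M i)"
    and g[measurable]: "\<And>i. g i \<in> borel_measurable (M i)"
    and prob: "\<And>i. (\<integral>\<^sup>+x. f i x \<partial>M i) = 1"
    and overlap: "\<And>i. ennreal (1 - e) \<le> (\<integral>\<^sup>+x. min (f i x) (g i x) \<partial>M i)"
    and e: "0 \<le> e" "e \<le> 1"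
  shows "total_variation (density (PiM I M) (\<lambda>x. \<Prod>i\<in>I. f i (x i)))
           (density (PiM I M) (\<lambda>x. \<Prod>i\<in>I. g i (x i))) \<le> card I * e"
proof -
  interpret M: product_sigma_finite M by fact
  let ?J = "\<integral>\<^sup>+x. min (\<Prod>i\<in>I. f i (x i)) (\<Prod>i\<in>I. g i (x i)) \<partial>PiM I M"
  have "ennreal ((1 - e) ^ card I) = (\<Prod>i\<in>I. ennreal (1 - e))"
    using e by (simp add: ennreal_power)
  also have "\<dots> \<le> (\<Prod>i\<in>I. \<integral>\<^sup>+x. min (f i x) (g i x) \<partial>M i)"
    by (intro prod_mono_ennreal overlap)
  also have "\<dots> = (\<integral>\<^sup>+x. (\<Prod>i\<in>I. min (f i (x i)) (g i (x i))) \<partial>PiM I M)"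
    using \<open>finite I\<close> by (intro M.product_nn_integral_prod[symmetric]) auto
  also have "\<dots> \<le> ?J"
    by (intro nn_integral_mono min.boundedI prod_mono_ennreal) auto
  finally have lower: "ennreal ((1 - e) ^ card I) \<le> ?J" .
  have "?J \<le> (\<integral>\<^sup>+x. (\<Prod>i\<in>I. f i (x i)) \<partial>PiM I M)"
    by (intro nn_integral_mono) auto
  also have "\<dots> = (\<Prod>i\<in>I. \<integral>\<^sup>+x. f i x \<partial>M i)"
    using \<open>finite I\<close> by (intro M.product_nn_integral_prod) auto
  also have "\<dots> = 1"
    using prob by simp
  \<comment> \<open>Finiteness matters: \<open>enn2real\<close> sends an infinite overlap to \<open>0\<close>.\<close>
  finally have "?J < \<top>"
    using ennreal_one_less_top by (rule le_less_trans)
  then have "(1 - e) ^ card I \<le> enn2real ?J"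
    using enn2real_mono[OF lower] e by simp
  moreover have "1 - card I * e \<le> (1 - e) ^ card I"
    using Bernoulli_inequality[of "- e" "card I"] e by simp
  ultimately show ?thesis
    by (subst total_variation_density) auto
qed

section \<open>Gaussian densities on dyadic cells\<close>

lemma discretize_measurable [measurable]: "discretize t \<in> borel_measurable borel"
  unfolding discretize_def by measurable

lemma mem_cell_iff:
  "y \<in> {discretize t x..<discretize t x + 1 / 2 ^ t} \<longleftrightarrow> discretize t y = discretize t x"
proof -
  have "y \<in> {discretize t x..<discretize t x + 1 / 2 ^ t}
      \<longleftrightarrow> of_int \<lfloor>2 ^ t * x\<rfloor> \<le> 2 ^ t * y \<and> 2 ^ t * y < of_int \<lfloor>2 ^ t * x\<rfloor> + 1"
    by (simp add: discretize_def add_divide_distrib[symmetric] pos_divide_le_eq pos_less_divide_eq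
        mult.commute)
  also have "\<dots> \<longleftrightarrow> \<lfloor>2 ^ t * y\<rfloor> = \<lfloor>2 ^ t * x\<rfloor>"
    by (simp add: floor_eq_iff)
  finally show ?thesis
    by (simp add: discretize_def)
qed

lemma discretize_idem [simp]: "discretize t (discretize t x) = discretize t x"
  by (simp add: discretize_def)

text \<open>The density, as a function of \<open>y\<close>, of the uniform distribution on the dyadic cell of \<open>x\<close>.\<close>

definition cell_density :: "nat \<Rightarrow> real \<Rightarrow> real \<Rightarrow> ennreal" where
  "cell_density t x y = 2 ^ t * indicator {discretize t x..<discretize t x + 1 / 2 ^ t} y"

text \<open>Lying in a common cell is an equivalence relation, which makes the density symmetric in its two
  arguments; the interval form is the one that integrates.\<close>

lemma cell_density_altdef:
  "cell_density t x y = (if discretize t x = discretize t y then 2 ^ t else 0)"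
  using mem_cell_iff[of y t x] by (auto simp: cell_density_def indicator_def)

lemma cell_density_commute: "cell_density t x y = cell_density t y x"
  by (simp add: cell_density_altdef)

lemma cell_density_discretize [simp]: "cell_density t (discretize t x) y = cell_density t x y"
  by (simp add: cell_density_altdef)

lemma cell_density_measurable [measurable]:
  assumes [measurable]: "f \<in> borel_measurable M" "g \<in> borel_measurable M"
  shows "(\<lambda>x. cell_density t (f x) (g x)) \<in> borel_measurable M"
  unfolding cell_density_altdef by measurable

lemma nn_integral_cell_density: "(\<integral>\<^sup>+y. cell_density t x y \<partial>lborel) = 1"
proof -
  have "(\<integral>\<^sup>+y. cell_density t x y \<partial>lborel) = 2 ^ t * ennreal (1 / 2 ^ t)"
    by (simp add: cell_density_def nn_integral_cmult)
  also have "\<dots> = ennreal (2 ^ t * (1 / 2 ^ t))"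
    by (subst ennreal_mult) (simp_all add: ennreal_power[symmetric])
  finally show ?thesis by simp
qed

lemma cell_density_nonzero_imp_close:
  assumes "cell_density t x y \<noteq> 0"
  shows "\<bar>x - y\<bar> < 1 / 2 ^ t"
proof -
  have "x \<in> {discretize t x..<discretize t x + 1 / 2 ^ t}"
    "y \<in> {discretize t x..<discretize t x + 1 / 2 ^ t}"
    using assms unfolding mem_cell_iff by (auto simp: cell_density_altdef split: if_splits)
  then show ?thesis by (auto simp: abs_if)
qed

text \<open>The average of the Gaussian density over the dyadic cell of \<open>y\<close>: the density of a variable
  obtained by discretizing a Gaussian and then drawing uniformly from its cell.\<close>

definition smoothed_density :: "nat \<Rightarrow> real \<Rightarrow> real \<Rightarrow> ennreal" where
  "smoothed_density t \<mu> y = (\<integral>\<^sup>+x. normal_density \<mu> 1 x * cell_density t x y \<partial>lborel)"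

lemma smoothed_density_measurable [measurable]: "smoothed_density t \<mu> \<in> borel_measurable borel"
  unfolding smoothed_density_def by measurable

lemma normal_density_antimono:
  assumes "\<bar>x - \<mu>\<bar> \<le> \<bar>y - \<mu>\<bar>"
  shows "normal_density \<mu> 1 y \<le> normal_density \<mu> 1 x"
  using assms by (simp add: normal_density_def abs_le_square_iff divide_right_mono)

lemma normal_density_le: "normal_density \<mu> 1 x \<le> 1 / 2"
proof -
  have "2 \<le> sqrt (2 * pi)"
    using pi_gt3 by (intro real_le_rsqrt) simp
  moreover have "normal_density \<mu> 1 x \<le> 1 / sqrt (2 * pi)"
    by (simp add: normal_density_def divide_right_mono)
  ultimately show ?thesis
    by (smt (verit) frac_le)
qed

lemma nn_integral_normal_density: "(\<integral>\<^sup>+x. normal_density \<mu> 1 x \<partial>lborel) = 1"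
  by (simp add: nn_integral_eq_integral)

text \<open>The graph of \<open>y \<mapsto> \<phi> (\<mu> + (\<bar>y - \<mu>\<bar> + h))\<close> arises from that of \<open>\<phi>\<close> by removing the part over
  \<open>[\<mu> - h, \<mu> + h)\<close>, whose mass is at most \<open>2 * h * (1 / 2)\<close>, and translating the two tails by \<open>h\<close>
  towards \<open>\<mu>\<close>.\<close>

lemma normal_density_shifted_mass:
  assumes "0 \<le> h" "h \<le> 1"
  shows "ennreal (1 - h) \<le> (\<integral>\<^sup>+y. normal_density \<mu> 1 (\<mu> + (\<bar>y - \<mu>\<bar> + h)) \<partial>lborel)"
proof -
  let ?\<phi> = "\<lambda>x. ennreal (normal_density \<mu> 1 x)"
  let ?m = "\<integral>\<^sup>+y. ?\<phi> (\<mu> + (\<bar>y - \<mu>\<bar> + h)) \<partial>lborel"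
  let ?L = "{..<\<mu> - h}" and ?C = "{\<mu> - h..<\<mu> + h}" and ?R = "{\<mu> + h..}"
  have sym: "?\<phi> (\<mu> - z) = ?\<phi> (\<mu> + z)" for z
    by (simp add: normal_density_def)
  have "1 = (\<integral>\<^sup>+x. ?\<phi> x * indicator ?L x + ?\<phi> x * indicator ?R x + ?\<phi> x * indicator ?C x \<partial>lborel)"
    unfolding nn_integral_normal_density[of \<mu>, symmetric]
    using assms by (intro nn_integral_cong) (auto simp: indicator_def)
  also have "\<dots> = (\<integral>\<^sup>+x. ?\<phi> x * indicator ?L x \<partial>lborel) + (\<integral>\<^sup>+x. ?\<phi> x * indicator ?R x \<partial>lborel)
      + (\<integral>\<^sup>+x. ?\<phi> x * indicator ?C x \<partial>lborel)"
    by (simp add: nn_integral_add)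
  also have "(\<integral>\<^sup>+x. ?\<phi> x * indicator ?L x \<partial>lborel)
      = (\<integral>\<^sup>+y. ?\<phi> (y - h) * indicator {..<\<mu>} y \<partial>lborel)"
    by (subst nn_integral_real_affine[where c = 1 and t = "- h"])
      (auto simp: indicator_def intro!: nn_integral_cong)
  also have "(\<integral>\<^sup>+x. ?\<phi> x * indicator ?R x \<partial>lborel)
      = (\<integral>\<^sup>+y. ?\<phi> (y + h) * indicator {\<mu>..} y \<partial>lborel)"
    by (subst nn_integral_real_affine[where c = 1 and t = h])
      (auto simp: indicator_def add.commute intro!: nn_integral_cong)
  also have "(\<integral>\<^sup>+y. ?\<phi> (y - h) * indicator {..<\<mu>} y \<partial>lborel)
      + (\<integral>\<^sup>+y. ?\<phi> (y + h) * indicator {\<mu>..} y \<partial>lborel)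
      = (\<integral>\<^sup>+y. ?\<phi> (y - h) * indicator {..<\<mu>} y + ?\<phi> (y + h) * indicator {\<mu>..} y \<partial>lborel)"
    by (rule nn_integral_add[symmetric]) auto
  also have "\<dots> = ?m"
  proof (rule nn_integral_cong)
    fix y
    show "?\<phi> (y - h) * indicator {..<\<mu>} y + ?\<phi> (y + h) * indicator {\<mu>..} y
        = ?\<phi> (\<mu> + (\<bar>y - \<mu>\<bar> + h))"
      using sym[of "\<mu> - y + h"] by (cases "y < \<mu>") (auto simp: algebra_simps)
  qed
  also have "(\<integral>\<^sup>+x. ?\<phi> x * indicator ?C x \<partial>lborel) \<le> (\<integral>\<^sup>+x. ennreal (1 / 2) * indicator ?C x \<partial>lborel)"
    by (intro nn_integral_mono mult_right_mono ennreal_leI normal_density_le) simp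
  also have "\<dots> = ennreal h"
    using assms ennreal_mult[of "1 / 2" "2 * h"] by (subst nn_integral_cmult_indicator) auto
  finally have "1 \<le> ?m + ennreal h"
    by simp
  then show ?thesis
    using assms by (simp add: ennreal_minus[symmetric] ennreal_minus_le_iff add.commute)
qed

text \<open>Every point of the cell of \<open>y\<close> is at distance at most \<open>\<bar>y - \<mu>\<bar> + 1 / 2 ^ t\<close> from \<open>\<mu>\<close>, so a single
  function bounds below both the density at \<open>y\<close> and its average over the cell.\<close>

lemma normal_smoothed_overlap:
  "ennreal (1 - 1 / 2 ^ t)
     \<le> (\<integral>\<^sup>+y. min (ennreal (normal_density \<mu> 1 y)) (smoothed_density t \<mu> y) \<partial>lborel)"
proof -
  let ?h = "1 / 2 ^ t :: real"
  let ?m = "\<lambda>y. ennreal (normal_density \<mu> 1 (\<mu> + (\<bar>y - \<mu>\<bar> + ?h)))"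
  have "?m y \<le> ennreal (normal_density \<mu> 1 y)" for y
    by (intro ennreal_leI normal_density_antimono) simp
  moreover have "?m y \<le> smoothed_density t \<mu> y" for y
  proof -
    have "?m y = (\<integral>\<^sup>+x. ?m y * cell_density t x y \<partial>lborel)"
      by (simp add: nn_integral_cmult cell_density_commute[of t _ y] nn_integral_cell_density)
    also have "\<dots> \<le> smoothed_density t \<mu> y"
      unfolding smoothed_density_def
    proof (rule nn_integral_mono)
      fix x
      show "?m y * cell_density t x y \<le> normal_density \<mu> 1 x * cell_density t x y"
      proof (cases "cell_density t x y = 0")
        case False
        then have "\<bar>x - \<mu>\<bar> \<le> \<bar>y - \<mu>\<bar> + ?h"
          using cell_density_nonzero_imp_close by (smt (verit))
        then show ?thesis
          by (intro mult_right_mono ennreal_leI normal_density_antimono) auto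
      qed simp
    qed
    finally show ?thesis .
  qed
  ultimately have "(\<integral>\<^sup>+y. ?m y \<partial>lborel)
      \<le> (\<integral>\<^sup>+y. min (ennreal (normal_density \<mu> 1 y)) (smoothed_density t \<mu> y) \<partial>lborel)"
    by (intro nn_integral_mono) simp
  then show ?thesis
    by (rule order_trans[OF normal_density_shifted_mass, rotated 2]) simp_all
qed

section \<open>The randomization kernel\<close>

lemma product_sigma_finite_lborel: "product_sigma_finite (\<lambda>_. lborel)"
  by unfold_locales

lemma sets_matrix_borel [measurable_cong]: "sets (matrix_borel p) = sets (PiM (entries p) (\<lambda>_. lborel))"
  unfolding matrix_borel_def by (intro sets_PiM_cong) auto

lemma gaussian_law_density:
  "gaussian_law p \<theta>
     = density (PiM (entries p) (\<lambda>_. lborel)) (\<lambda>x. \<Prod>ij\<in>entries p. normal_density (\<theta> ij) 1 (x ij))"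
  unfolding gaussian_law_def
  by (subst density_PiM[OF _ product_sigma_finite_lborel])
    (auto simp: prod_ennreal
      intro!: prob_space_imp_sigma_finite prob_space_normal_density)

definition cell_kernel :: "nat \<Rightarrow> nat \<Rightarrow> (nat \<times> nat \<Rightarrow> real) \<Rightarrow> (nat \<times> nat \<Rightarrow> real) measure" where
  "cell_kernel p t x = density (PiM (entries p) (\<lambda>_. lborel))
     (\<lambda>y. \<Prod>ij\<in>entries p. cell_density t (x ij) (y ij))"

lemma prob_space_cell_kernel: "prob_space (cell_kernel p t x)"
proof -
  have cell: "prob_space (density lborel (cell_density t (x ij)))" for ij
    by (rule prob_spaceI) (simp add: emeasure_density nn_integral_cell_density)
  then have "cell_kernel p t x = PiM (entries p) (\<lambda>ij. density lborel (cell_density t (x ij)))"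
    unfolding cell_kernel_def
    by (intro density_PiM[OF _ product_sigma_finite_lborel, symmetric])
      (auto intro: prob_space_imp_sigma_finite)
  then show ?thesis
    using cell by (simp add: prob_space_PiM)
qed

lemma sigma_finite_lborel_matrices: "sigma_finite_measure (PiM (entries p) (\<lambda>_. lborel :: real measure))"
  by (rule product_sigma_finite.sigma_finite[OF product_sigma_finite_lborel]) simp

lemma cell_kernel_density_measurable:
  "(\<lambda>(x, y). \<Prod>ij\<in>entries p. cell_density t (x ij) (y ij))
     \<in> borel_measurable (PiM (entries p) (\<lambda>_. lborel) \<Otimes>\<^sub>M PiM (entries p) (\<lambda>_. lborel))"
  by measurable

text \<open>Lebesgue measure on matrices and \<open>matrix_borel\<close> share their \<open>\<sigma>\<close>-algebra, and \<open>prob_algebra\<close>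
  depends on nothing else.\<close>

lemma cell_kernel_measurable: "cell_kernel p t \<in> matrix_borel p \<rightarrow>\<^sub>M prob_algebra (matrix_borel p)"
proof -
  have "(\<lambda>x. cell_kernel p t x)
      \<in> PiM (entries p) (\<lambda>_. lborel) \<rightarrow>\<^sub>M prob_algebra (PiM (entries p) (\<lambda>_. lborel))"
    unfolding cell_kernel_def
    by (rule measurable_density_kernel[OF sigma_finite_lborel_matrices cell_kernel_density_measurable])
      (use prob_space_cell_kernel in \<open>simp add: cell_kernel_def\<close>)
  moreover have "prob_algebra (matrix_borel p) = prob_algebra (PiM (entries p) (\<lambda>_. lborel))"
    by (simp add: prob_algebra_def subprob_algebra_cong[OF sets_matrix_borel])
  ultimately show ?thesis
    using measurable_cong_sets[OF sets_matrix_borel refl] by auto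
qed

lemma cell_kernel_discretize_matrix: "cell_kernel p t (discretize_matrix p t x) = cell_kernel p t x"
  by (simp add: cell_kernel_def discretize_matrix_def)

text \<open>The kernel reads its input only through the cells, so it may be applied to the Gaussian matrix
  itself. The resulting mixture is over independent entries, hence factorizes.\<close>

lemma discretized_gaussian_law_bind_cell_kernel:
  "discretized_gaussian_law p t \<theta> \<bind> cell_kernel p t
     = density (PiM (entries p) (\<lambda>_. lborel)) (\<lambda>y. \<Prod>ij\<in>entries p. smoothed_density t (\<theta> ij) (y ij))"
proof -
  let ?L = "PiM (entries p) (\<lambda>_. lborel) :: (nat \<times> nat \<Rightarrow> real) measure"
  let ?f = "\<lambda>x. ennreal (\<Prod>ij\<in>entries p. normal_density (\<theta> ij) 1 (x ij))"
  let ?k = "\<lambda>x y. \<Prod>ij\<in>entries p. cell_density t (x ij) (y ij)"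
  have sets: "sets (gaussian_law p \<theta>) = sets (matrix_borel p)"
    and prob: "prob_space (gaussian_law p \<theta>)"
    using gaussian_law_in_prob_algebra by (auto simp: space_prob_algebra)
  have "discretized_gaussian_law p t \<theta> \<bind> cell_kernel p t
      = gaussian_law p \<theta> \<bind> (\<lambda>x. cell_kernel p t (discretize_matrix p t x))"
    unfolding discretized_gaussian_law_def
    using measurable_discretize_matrix[of p t] prob_space.not_empty[OF prob]
      measurable_cong_sets[OF sets refl]
    by (intro bind_distr[OF _ measurable_prob_algebraD[OF cell_kernel_measurable]]) auto
  also have "\<dots> = density ?L ?f \<bind> (\<lambda>x. density ?L (?k x))"
    unfolding cell_kernel_discretize_matrix by (simp add: gaussian_law_density cell_kernel_def)
  also have "\<dots> = density ?L (\<lambda>y. \<integral>\<^sup>+x. ?f x * ?k x y \<partial>?L)"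
    using prob prob_space_cell_kernel
    by (intro bind_density_kernel sigma_finite_lborel_matrices cell_kernel_density_measurable)
      (auto simp: gaussian_law_density cell_kernel_def)
  also have "(\<lambda>y. \<integral>\<^sup>+x. ?f x * ?k x y \<partial>?L) = (\<lambda>y. \<Prod>ij\<in>entries p. smoothed_density t (\<theta> ij) (y ij))"
  proof
    fix y
    have "(\<integral>\<^sup>+x. ?f x * ?k x y \<partial>?L)
        = (\<integral>\<^sup>+x. (\<Prod>ij\<in>entries p. ennreal (normal_density (\<theta> ij) 1 (x ij))
            * cell_density t (x ij) (y ij)) \<partial>?L)"
      by (simp add: prod_ennreal prod.distrib)
    also have "\<dots> = (\<Prod>ij\<in>entries p. smoothed_density t (\<theta> ij) (y ij))"
      unfolding smoothed_density_def
      by (rule product_sigma_finite.product_nn_integral_prod[OF product_sigma_finite_lborel]) auto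
    finally show "(\<integral>\<^sup>+x. ?f x * ?k x y \<partial>?L) = (\<Prod>ij\<in>entries p. smoothed_density t (\<theta> ij) (y ij))" .
  qed
  finally show ?thesis .
qed

lemma total_variation_cell_kernel_le:
  "total_variation (discretized_gaussian_law p t \<theta> \<bind> cell_kernel p t) (gaussian_law p \<theta>)
     \<le> (real p)\<^sup>2 / 2 ^ t"
proof -
  let ?L = "PiM (entries p) (\<lambda>_. lborel) :: (nat \<times> nat \<Rightarrow> real) measure"
  have "total_variation
      (density ?L (\<lambda>x. \<Prod>ij\<in>entries p. ennreal (normal_density (\<theta> ij) 1 (x ij))))
      (density ?L (\<lambda>x. \<Prod>ij\<in>entries p. smoothed_density t (\<theta> ij) (x ij)))
      \<le> real (card (entries p)) * (1 / 2 ^ t)"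
    by (intro total_variation_product_le product_sigma_finite_lborel normal_smoothed_overlap
        nn_integral_normal_density) auto
  then show ?thesis
    by (subst total_variation_commute)
      (simp_all add: discretized_gaussian_law_bind_cell_kernel gaussian_law_density prod_ennreal
        power2_eq_square)
qed

section \<open>The Le Cam distance\<close>

lemma matrices_nonempty: "matrices p \<noteq> {}"
  by (simp add: matrices_def PiE_eq_empty_iff)

interpretation discretization:
  experiment_pair "gaussian_experiment p" "discretized_gaussian_experiment p t" for p t
  by unfold_locales
    (simp_all add: gaussian_experiment_def discretized_gaussian_experiment_def matrices_nonempty
      gaussian_law_in_prob_algebra discretized_gaussian_law_in_prob_algebra)

interpretation randomization:
  experiment_pair "discretized_gaussian_experiment p t" "gaussian_experiment p" for p t
  by unfold_locales
    (simp_all add: gaussian_experiment_def discretized_gaussian_experiment_def matrices_nonempty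
      gaussian_law_in_prob_algebra discretized_gaussian_law_in_prob_algebra)

lemma discretization_kernel:
  "(\<lambda>x. return (matrix_borel p) (discretize_matrix p t x))
     \<in> matrix_borel p \<rightarrow>\<^sub>M prob_algebra (matrix_borel p)"
  using measurable_compose[OF measurable_discretize_matrix measurable_return_prob_space] .

lemma deficiency_discretized_le_0:
  "deficiency (gaussian_experiment p) (discretized_gaussian_experiment p t) \<le> 0"
proof (rule discretization.deficiency_le)
  show "(\<lambda>x. return (matrix_borel p) (discretize_matrix p t x))
      \<in> sample (gaussian_experiment p) \<rightarrow>\<^sub>M prob_algebra (sample (discretized_gaussian_experiment p t))"
    using discretization_kernel
    by (simp add: gaussian_experiment_def discretized_gaussian_experiment_def)
next
  fix \<theta>
  have sets: "sets (gaussian_law p \<theta>) = sets (matrix_borel p)"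
    and prob: "prob_space (gaussian_law p \<theta>)"
    using gaussian_law_in_prob_algebra by (auto simp: space_prob_algebra)
  have "gaussian_law p \<theta> \<bind> (\<lambda>x. return (matrix_borel p) (discretize_matrix p t x))
      = discretized_gaussian_law p t \<theta>"
    unfolding discretized_gaussian_law_def
    using measurable_discretize_matrix[of p t] measurable_cong_sets[OF sets refl]
    by (intro bind_return_distr' prob_space.not_empty[OF prob]) auto
  then show "total_variation (law (gaussian_experiment p) \<theta>
        \<bind> (\<lambda>x. return (matrix_borel p) (discretize_matrix p t x)))
      (law (discretized_gaussian_experiment p t) \<theta>) \<le> 0"
    using discretized_gaussian_law_in_prob_algebra[of p t \<theta>]
    by (simp add: gaussian_experiment_def discretized_gaussian_experiment_def space_prob_algebra
        total_variation_self)
qed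

lemma deficiency_gaussian_le:
  "deficiency (discretized_gaussian_experiment p t) (gaussian_experiment p) \<le> (real p)\<^sup>2 / 2 ^ t"
  by (rule randomization.deficiency_le[where T = "cell_kernel p t"])
    (simp_all add: gaussian_experiment_def discretized_gaussian_experiment_def
      cell_kernel_measurable total_variation_cell_kernel_le)

lemma le_cam_dist_nonneg:
  "0 \<le> le_cam_dist (gaussian_experiment p) (discretized_gaussian_experiment p t)"
proof -
  have "0 \<le> deficiency (discretized_gaussian_experiment p t) (gaussian_experiment p)"
    by (rule randomization.deficiency_nonneg[where T = "cell_kernel p t"])
      (simp add: gaussian_experiment_def discretized_gaussian_experiment_def cell_kernel_measurable)
  then show ?thesis
    by (simp add: le_cam_dist_def)
qed

lemma le_cam_dist_le:
  "le_cam_dist (gaussian_experiment p) (discretized_gaussian_experiment p t) \<le> (real p)\<^sup>2 / 2 ^ t"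
proof -
  have "0 \<le> (real p)\<^sup>2 / 2 ^ t"
    by simp
  then show ?thesis
    unfolding le_cam_dist_def using deficiency_discretized_le_0 deficiency_gaussian_le
    by (meson max.boundedI order_trans)
qed

lemma le_cam_dist_le_powr:
  "le_cam_dist (gaussian_experiment p) (discretized_gaussian_experiment p t)
     \<le> 2 * (real p)\<^sup>2 * 2 powr (- 2 * real t / 3)"
proof -
  have "1 / 2 ^ t = 2 powr (- real t)"
    by (simp add: powr_minus powr_realpow field_simps)
  also have "\<dots> \<le> 2 powr (- 2 * real t / 3)"
    by (intro powr_mono) auto
  also have "\<dots> \<le> 2 * 2 powr (- 2 * real t / 3)"
    by simp
  finally have "(real p)\<^sup>2 * (1 / 2 ^ t) \<le> (real p)\<^sup>2 * (2 * 2 powr (- 2 * real t / 3))"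
    by (rule mult_left_mono) simp
  with le_cam_dist_le[of p t] show ?thesis
    by simp
qed

text \<open>The growth condition gives \<open>p ^ 3 \<le> 2 ^ t p\<close>, so that \<open>p\<^sup>2 / 2 ^ t p\<close> is at most \<open>1 / p\<close>.\<close>

lemma asymptotically_equivalent_discretized:
  assumes "0 < \<epsilon>" and t: "\<And>p. p \<ge> 1 \<Longrightarrow> (3 + \<epsilon>) * log 2 (real p) \<le> real (t p)"
  shows "asymptotically_equivalent gaussian_experiment (\<lambda>p. discretized_gaussian_experiment p (t p))"
  unfolding asymptotically_equivalent_def
proof (rule tendsto_sandwich)
  show "\<forall>\<^sub>F p in sequentially. 0 \<le> le_cam_dist (gaussian_experiment p) (discretized_gaussian_experiment p (t p))"
    by (simp add: le_cam_dist_nonneg)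
  have "le_cam_dist (gaussian_experiment p) (discretized_gaussian_experiment p (t p)) \<le> 1 / real p"
    if "p \<ge> 1" for p
  proof -
    have "3 * log 2 (real p) \<le> (3 + \<epsilon>) * log 2 (real p)"
      using that assms(1) by (intro mult_right_mono) auto
    then have "real p powr 3 \<le> 2 powr real (t p)"
      using that t[OF that] powr_mono[of "3 * log 2 (real p)" "real (t p)" 2]
      by (simp add: powr_powr[symmetric] mult.commute[of 3])
    then have "real p ^ 3 \<le> 2 ^ t p"
      using that powr_realpow[of "real p" 3] by (simp add: powr_realpow)
    then have "(real p)\<^sup>2 / 2 ^ t p \<le> (real p)\<^sup>2 / real p ^ 3"
      using that by (intro divide_left_mono) auto
    also have "\<dots> = 1 / real p"
      by (simp add: power2_eq_square power3_eq_cube)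
    finally show ?thesis
      using le_cam_dist_le[of p "t p"] by simp
  qed
  then show "\<forall>\<^sub>F p in sequentially. le_cam_dist (gaussian_experiment p) (discretized_gaussian_experiment p (t p)) \<le> 1 / real p"
    by (auto simp: eventually_sequentially)
  show "(\<lambda>p. 1 / real p) \<longlonglongrightarrow> 0"
    by (rule lim_1_over_n)
qed simp

theorem theorem1:
  "(\<forall>t p :: nat.
      le_cam_dist (gaussian_experiment p) (discretized_gaussian_experiment p t)
        \<le> 2 * (real p)\<^sup>2 * 2 powr (- 2 * real t / 3)) \<and>
   (\<forall>(\<epsilon> :: real) (t :: nat \<Rightarrow> nat).
      \<epsilon> > 0 \<longrightarrow>
      (\<forall>p\<ge>1. real (t p) \<ge> (3 + \<epsilon>) * log 2 (real p)) \<longrightarrow>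
      asymptotically_equivalent gaussian_experiment
        (\<lambda>p. discretized_gaussian_experiment p (t p)))"
  using le_cam_dist_le_powr asymptotically_equivalent_discretized by blast

end
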